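(* Let $\sigma$ be a permutation of size $n$ ending with its maximum, and with $k$ left-to-right maxima. Then the cardinality of $\mathbf{B}^{-1}(\sigma)$ is $2^{k-1}$, and for any $1\le j\le k$, the number of preimages of $\sigma$ under $\mathbf{B}$ with exactly $j$ left-to-right maxima is $\binom{k-1}{j-1}$.
   Context: A permutation of size $n$ is a sequence $\pi=\pi_1\pi_2\dots\pi_n$ containing each of $1,\dots,n$ exactly once. An element $\pi_j$ is a left-to-right maximum of $\pi$ if $\pi_j>\pi_i$ for all $i<j$. The bubblesort operator $\mathbf{B}$ is one pass of the bubblesort algorithm: scan the positions from left to right, each time exchanging the current element with the one to its right whenever the latter is smaller. Equivalently, writing $\pi=\mu_1A_1\mu_2A_2\dots\mu_kA_k$ where the $\mu_i$ are all the left-to-right maxima of $\pi$ (and the $A_i$ are possibly empty sequences), $\mathbf{B}(\pi)=A_1\mu_1A_2\mu_2\dots A_k\mu_k$. $\mathbf{B}^{-1}(\sigma)$ denotes the set of preimages of $\sigma$, i.e. permutations $\pi$ with $\mathbf{B}(\pi)=\sigma$. *)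

theory Defs
  imports "HOL-Combinatorics.Multiset_Permutations"
begin

text \<open>A permutation of size \<open>n\<close> is a list in \<open>permutations_of_set {1..n}\<close>, that is, a list without
  repetitions whose set of elements is \<open>{1..n}\<close>; list positions count from 0.\<close>

definition lr_maxima :: "nat list \<Rightarrow> nat set" where
  "lr_maxima p = {p ! j | j. j < length p \<and> (\<forall>i<j. p ! i < p ! j)}"

text \<open>One pass of bubblesort: the head of the argument is the element currently scanned.\<close>

fun bubblesort_pass :: "nat list \<Rightarrow> nat list" where
  "bubblesort_pass [] = []"
| "bubblesort_pass [x] = [x]"
| "bubblesort_pass (x # y # zs) =
     (if y < x then y # bubblesort_pass (x # zs) else x # bubblesort_pass (y # zs))"

definition bubblesort_preimages :: "nat list \<Rightarrow> nat list set" where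
  "bubblesort_preimages s =
     {p. (\<exists>m. p \<in> permutations_of_set {1..m}) \<and> bubblesort_pass p = s}"

end

theory Submission
  imports Defs
begin

text \<open>Read from the right, one pass acts simply: appending \<open>y\<close> to \<open>q\<close> appends \<open>y\<close> to the image if
  \<open>y\<close> is at least the maximum of \<open>q\<close>, and otherwise inserts \<open>y\<close> just before the final entry of the
  image. Hence a preimage of \<open>t y m\<close>, with \<open>y < m\<close>, is either \<open>q m\<close> with \<open>q\<close> a preimage of \<open>t y\<close>,
  or \<open>q y\<close> with \<open>q\<close> a preimage of \<open>t m\<close>. The first kind exists only if \<open>y\<close> is a left-to-right
  maximum, and it adds one left-to-right maximum to those of \<open>q\<close>; the second kind adds none. Counting
  thus reduces to Pascal's rule.\<close>

lemma bubblesort_pass_eq_Nil_iff [simp]: "bubblesort_pass p = [] \<longleftrightarrow> p = []"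
  by (induction p rule: bubblesort_pass.induct) auto

lemma mset_bubblesort_pass [simp]: "mset (bubblesort_pass p) = mset p"
  by (induction p rule: bubblesort_pass.induct) auto

lemma set_bubblesort_pass [simp]: "set (bubblesort_pass p) = set p"
  by (metis mset_bubblesort_pass set_mset_mset)

lemma distinct_bubblesort_pass [simp]: "distinct (bubblesort_pass p) \<longleftrightarrow> distinct p"
  by (metis mset_bubblesort_pass mset_eq_imp_distinct_iff)

text \<open>The scanned element is always the largest met so far, and the pass writes it last. In
  the induction the element left behind is bounded through the one carried on.\<close>

lemma last_bubblesort_pass_ge: "x \<in> set p \<Longrightarrow> x \<le> last (bubblesort_pass p)"
proof (induction p arbitrary: x rule: bubblesort_pass.induct)
  case (3 a b zs)
  show ?case
  proof (cases "b < a")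
    case True
    then have "a \<le> last (bubblesort_pass (a # zs))" by (intro "3.IH"(1)) auto
    with True have "b \<le> last (bubblesort_pass (a # zs))" by simp
    with True 3 show ?thesis by auto
  next
    case False
    then have "b \<le> last (bubblesort_pass (b # zs))" by (intro "3.IH"(2)) auto
    with False have "a \<le> last (bubblesort_pass (b # zs))" by simp
    with False 3 show ?thesis by auto
  qed
qed auto

text \<open>After the scan of \<open>q\<close> the carried element is the last entry of the image;
  an appended \<open>y\<close> causes exactly one further comparison, with that entry.\<close>

lemma bubblesort_pass_snoc:
  assumes "q \<noteq> []"
  shows "bubblesort_pass (q @ [y]) = butlast (bubblesort_pass q) @
    (let z = last (bubblesort_pass q) in if y < z then [y, z] else [z, y])"
  using assms by (induction q rule: bubblesort_pass.induct) (auto simp: Let_def)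

lemma lr_maxima_subset: "lr_maxima p \<subseteq> set p"
  by (auto simp: lr_maxima_def)

lemma finite_lr_maxima [simp]: "finite (lr_maxima p)"
  using lr_maxima_subset by (rule finite_subset) simp

lemma lr_maxima_Nil [simp]: "lr_maxima [] = {}"
  by (simp add: lr_maxima_def)

lemma lr_maxima_snoc:
  "lr_maxima (q @ [y]) = (if \<forall>x\<in>set q. x < y then insert y (lr_maxima q) else lr_maxima q)"
proof -
  let ?r = "q @ [y]"
  let ?Q = "\<lambda>j. \<forall>i<j. ?r ! i < ?r ! j"
  have "lr_maxima ?r = {?r ! j | j. j < length q \<and> ?Q j} \<union> (if ?Q (length q) then {y} else {})"
    unfolding lr_maxima_def length_append_singleton less_Suc_eq
    by (auto intro: exI[of _ "length q"])
  also have "{?r ! j | j. j < length q \<and> ?Q j} = lr_maxima q"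
    unfolding lr_maxima_def by (intro Collect_cong ex_cong1) (auto simp: nth_append)
  also have "?Q (length q) \<longleftrightarrow> (\<forall>x\<in>set q. x < y)"
    by (simp add: all_set_conv_all_nth nth_append)
  finally show ?thesis by auto
qed

lemma card_lr_maxima_snoc_max:
  "\<forall>x\<in>set q. x < y \<Longrightarrow> card (lr_maxima (q @ [y])) = Suc (card (lr_maxima q))"
  using lr_maxima_subset[of q] by (auto simp: lr_maxima_snoc card_insert_if)

lemma vimage_bubblesort_pass_singleton: "bubblesort_pass -` {[m]} = {[m]}"
proof -
  have "p = [m]" if "bubblesort_pass p = [m]" for p
    using that mset_bubblesort_pass[of p] by simp
  then show ?thesis by auto
qed

lemma vimage_bubblesort_pass_snoc2:
  assumes "y < m"
  shows "bubblesort_pass -` {t @ [y, m]} =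
    (\<lambda>q. q @ [m]) ` (bubblesort_pass -` {t @ [y]}) \<union>
    (\<lambda>q. q @ [y]) ` (bubblesort_pass -` {t @ [m]})" (is "?L = ?R")
proof
  show "?L \<subseteq> ?R"
  proof
    fix p assume "p \<in> ?L"
    then have p: "bubblesort_pass p = t @ [y, m]" by simp
    then obtain q z where qz: "p = q @ [z]"
      by (cases p rule: rev_cases) auto
    with p have "q \<noteq> []" by (cases q) auto
    then obtain u w where uw: "bubblesort_pass q = u @ [w]"
      by (cases "bubblesort_pass q" rule: rev_cases) auto
    \<comment> \<open>If \<open>z < w\<close>, the image ends in \<open>z\<close>, \<open>w\<close>,
      so \<open>z = y\<close> and \<open>w = m\<close>; otherwise it ends in \<open>w\<close>,
      \<open>z\<close>, so \<open>w = y\<close> and \<open>z = m\<close>. In both cases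
      \<open>u = t\<close>.\<close>
    from p uw show "p \<in> ?R"
      unfolding qz bubblesort_pass_snoc[OF \<open>q \<noteq> []\<close>]
      by (auto simp: Let_def split: if_splits)
  qed
next
  show "?R \<subseteq> ?L"
  proof
    fix p assume "p \<in> ?R"
    then obtain q a b where q: "bubblesort_pass q = t @ [a]" "p = q @ [b]"
      and ab: "a = y \<and> b = m \<or> a = m \<and> b = y" by auto
    then have "q \<noteq> []" by auto
    with q ab assms show "p \<in> ?L" by (auto simp: bubblesort_pass_snoc)
  qed
qed

lemma vimage_bubblesort_pass_empty:
  assumes "x \<in> set t" "y < x"
  shows "bubblesort_pass -` {t @ [y]} = {}"
proof -
  have "bubblesort_pass p \<noteq> t @ [y]" for p
  proof
    assume eq: "bubblesort_pass p = t @ [y]"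
    with set_bubblesort_pass[of p] assms have "x \<in> set p" by auto
    with eq assms last_bubblesort_pass_ge[of x p] show False by auto
  qed
  then show ?thesis by auto
qed

text \<open>Distinct lists replace permutations because prefixes of permutations need not be
  permutations. The final entry stays arbitrary since the induction hypothesis is used at both
  \<open>m\<close> and \<open>y\<close>. The value at \<open>j = 0\<close> serves Pascal's rule at
  the boundary.\<close>

lemma card_vimage_bubblesort_pass:
  assumes "distinct t" "\<forall>x\<in>set t. x < m"
  shows "finite (bubblesort_pass -` {t @ [m]}) \<and>
    card (bubblesort_pass -` {t @ [m]}) = 2 ^ card (lr_maxima t) \<and>
    (\<forall>j. card {p \<in> bubblesort_pass -` {t @ [m]}. card (lr_maxima p) = j} =
      (if j = 0 then 0 else card (lr_maxima t) choose (j - 1)))"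
  using assms
proof (induction t arbitrary: m rule: rev_induct)
  case Nil
  have "{p \<in> {[m]}. card (lr_maxima p) = j} = (if j = 1 then {[m]} else {})" for j
    using lr_maxima_snoc[of "[]" m] by auto
  then show ?case
    by (auto simp: vimage_bubblesort_pass_singleton)
next
  case (snoc y t)
  define V where "V a = bubblesort_pass -` {t @ [a]}" for a
  define W where "W a j = {p \<in> V a. card (lr_maxima p) = j}" for a j
  let ?X = "bubblesort_pass -` {(t @ [y]) @ [m]}"
  let ?Y = "\<lambda>j. {p \<in> ?X. card (lr_maxima p) = j}"
  let ?f = "\<lambda>(a::nat) q. q @ [a]"
  have t: "distinct t" "y \<notin> set t" "y < m" "\<forall>x\<in>set t. x < m"
    using snoc.prems by auto
  have X: "?X = ?f m ` V y \<union> ?f y ` V m"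
    using vimage_bubblesort_pass_snoc2[OF t(3), of t] by (simp add: V_def)
  have set_V: "set p = insert a (set t)" if "p \<in> V a" for p a
    using that set_bubblesort_pass[of p] by (auto simp: V_def)
  have lr_m: "card (lr_maxima (p @ [m])) = Suc (card (lr_maxima p))" if "p \<in> V y" for p
    using set_V[OF that] t by (intro card_lr_maxima_snoc_max) auto
  \<comment> \<open>Here \<open>p\<close> contains \<open>m\<close>, which exceeds the appended
    \<open>y\<close>.\<close>
  have lr_y: "lr_maxima (p @ [y]) = lr_maxima p" if "p \<in> V m" for p
    using set_V[OF that] t by (auto simp: lr_maxima_snoc)
  have Y: "?Y j = ?f m ` {p \<in> V y. Suc (card (lr_maxima p)) = j} \<union> ?f y ` W m j" for j
    unfolding X W_def using lr_m lr_y by force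
  have inj: "inj_on (?f a) A" for a A by (auto simp: inj_on_def)
  have IHm: "finite (V m)" "card (V m) = 2 ^ card (lr_maxima t)"
    "card (W m j) = (if j = 0 then 0 else card (lr_maxima t) choose (j - 1))" for j
    using snoc.IH[of m] t by (auto simp: V_def W_def)
  show ?case
  proof (cases "\<forall>x\<in>set t. x < y")
    case True
    have IHy: "finite (V y)" "card (V y) = 2 ^ card (lr_maxima t)"
      "card (W y j) = (if j = 0 then 0 else card (lr_maxima t) choose (j - 1))" for j
      using snoc.IH[of y] t True by (auto simp: V_def W_def)
    have lr_t: "card (lr_maxima (t @ [y])) = Suc (card (lr_maxima t))"
      using True by (rule card_lr_maxima_snoc_max)
    \<comment> \<open>The two images are disjoint, as their members end in the different entries
      \<open>m\<close> and \<open>y\<close>.\<close>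
    have "card ?X = card (?f m ` V y) + card (?f y ` V m)"
      unfolding X using t(3) IHm(1) IHy(1) by (intro card_Un_disjoint) auto
    then have 1: "card ?X = 2 ^ card (lr_maxima (t @ [y]))"
      by (simp add: card_image[OF inj] IHm IHy lr_t)
    have 2: "card (?Y j) = (if j = 0 then 0 else card (lr_maxima (t @ [y])) choose (j - 1))" for j
    proof -
      have "card (?Y j) = card (?f m ` {p \<in> V y. Suc (card (lr_maxima p)) = j})
          + card (?f y ` W m j)"
        unfolding Y W_def using t(3) IHm(1) IHy(1) by (intro card_Un_disjoint) auto
      also have "\<dots> = card {p \<in> V y. Suc (card (lr_maxima p)) = j} + card (W m j)"
        by (simp add: card_image[OF inj])
      also have "\<dots> = (if j = 0 then 0 else card (W y (j - 1))) + card (W m j)"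
        by (cases j) (auto simp: W_def)
      \<comment> \<open>Pascal's rule; the second case split isolates \<open>j = 1\<close>, where
        the first summand is \<open>0\<close> and the second is a binomial coefficient with lower
        index \<open>0\<close>.\<close>
      also have "\<dots> = (if j = 0 then 0 else Suc (card (lr_maxima t)) choose (j - 1))"
        by (cases j; cases "j - 1") (auto simp: IHm(3) IHy(3))
      finally show ?thesis by (simp add: lr_t)
    qed
    have "finite ?X" unfolding X using IHm(1) IHy(1) by simp
    with 1 2 show ?thesis by blast
  next
    case False
    then obtain x where "x \<in> set t" "y < x"
      using t(2) by (metis linorder_neqE_nat)
    then have Vy: "V y = {}"
      unfolding V_def by (rule vimage_bubblesort_pass_empty)
    have lr_t: "lr_maxima (t @ [y]) = lr_maxima t"
      unfolding lr_maxima_snoc using False by (rule if_not_P)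
    have "card ?X = card (V m)" "finite ?X"
      unfolding X using IHm(1) by (simp_all add: Vy card_image[OF inj])
    moreover have "card (?Y j) = card (W m j)" for j
      unfolding Y by (simp add: Vy card_image[OF inj])
    ultimately show ?thesis using IHm lr_t by simp
  qed
qed

text \<open>A pass preserves entries and distinctness, so any list sent to a permutation is itself
  one of the same size. This allows counting among all lists.\<close>

lemma bubblesort_preimages_eq_vimage:
  assumes "s \<in> permutations_of_set {1..n}"
  shows "bubblesort_preimages s = bubblesort_pass -` {s}"
proof -
  have "p \<in> permutations_of_set {1..n}" if "bubblesort_pass p = s" for p
    using assms set_bubblesort_pass[of p] distinct_bubblesort_pass[of p]
    by (simp add: that permutations_of_set_def)
  then show ?thesis by (auto simp: bubblesort_preimages_def)
qed

theorem corollary2p4: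
  fixes \<sigma> :: "nat list" and n k :: nat
  assumes "\<sigma> \<in> permutations_of_set {1..n}"
    and "\<sigma> \<noteq> []" and "last \<sigma> = Max (set \<sigma>)"
    and "card (lr_maxima \<sigma>) = k"
  shows "card (bubblesort_preimages \<sigma>) = 2 ^ (k - 1) \<and>
    (\<forall>j. 1 \<le> j \<and> j \<le> k \<longrightarrow>
      card {\<pi> \<in> bubblesort_preimages \<sigma>. card (lr_maxima \<pi>) = j} = (k - 1) choose (j - 1))"
proof -
  obtain t m where \<sigma>: "\<sigma> = t @ [m]"
    using assms(2) by (cases \<sigma> rule: rev_cases) auto
  have t: "distinct t" "m \<notin> set t"
    using assms(1) by (auto simp: \<sigma> permutations_of_set_def)
  have "\<forall>x\<in>set t. x \<le> m"
    using assms(3) Max_ge[of "set \<sigma>"] by (auto simp: \<sigma>)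
  with t(2) have lt: "\<forall>x\<in>set t. x < m"
    by (metis order_le_less)
  \<comment> \<open>The final maximum \<open>m\<close> is itself a left-to-right maximum, which
    accounts for the \<open>k - 1\<close>.\<close>
  have "k = Suc (card (lr_maxima t))"
    using assms(4) card_lr_maxima_snoc_max[OF lt] by (simp add: \<sigma>)
  then show ?thesis
    using card_vimage_bubblesort_pass[OF t(1) lt]
    by (simp add: bubblesort_preimages_eq_vimage[OF assms(1)] \<sigma>[symmetric])
qed

end
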